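(* Let $\breve{\mathbf{M}}\in\mathbb{H}_S^{m\times n}$, let $\mathcal{K}\subseteq\{1,\dots,n\}$ with $|\mathcal{K}|=r$, and let $\bar{\mathcal{K}}=\{1,\dots,n\}\setminus\mathcal{K}$. The following are equivalent. (a) $\breve{\mathbf{M}}$ is a separable quaternion matrix with column set $\mathcal{K}$, i.e. there is $\mathbf{H}\in\mathbb{R}^{r\times n}_+$ with $\breve{\mathbf{M}}=\breve{\mathbf{M}}(:,\mathcal{K})\mathbf{H}$. (b) Each of the four real component matrices $\mathcal{S}_l(\breve{\mathbf{M}})$, $l=0,1,2,3$, is separable, in the following compatible way: there exist index sets $\mathcal{K}_l\subseteq\{1,\dots,n\}$ with $|\mathcal{K}_l|=r_l\le r$ and matrices $\mathbf{H}_l\in\mathbb{R}^{r_l\times n}_+$ such that $$\mathcal{S}_l(\breve{\mathbf{M}})=\mathcal{S}_l(\breve{\mathbf{M}})(:,\mathcal{K}_l)\,\mathbf{H}_l,\qquad l=0,1,2,3;$$ at least one of the index sets contains the others, namely for some $p\in\{0,1,2,3\}$, $$\bigcup_{l=0}^{3}\mathcal{K}_l=\mathcal{K}_p=\mathcal{K};$$ and there exists a single matrix $\mathbf{Q}\in\mathbb{R}^{r\times(n-r)}_+$ such that for every $l=0,1,2,3$, $$\mathbf{H}_l(:,\bar{\mathcal{K}})=[\,\mathbf{I}_{r_l},\ \mathbf{H}_l(:,\mathcal{K}\setminus\mathcal{K}_l)\,]\,\Pi_l\,\mathbf{Q},$$ where $\Pi_l$ is the $r\times r$ permutation matrix that rearranges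 columns listed in the order ($\mathcal{K}_l$ first, then $\mathcal{K}\setminus\mathcal{K}_l$) into the order of $\mathcal{K}$. Moreover, when (b) holds, factor matrices with $\breve{\mathbf{M}}=\breve{\mathbf{W}}\mathbf{H}$ are given by $\breve{\mathbf{W}}=\breve{\mathbf{M}}(:,\mathcal{K})$ and $\mathbf{H}(:,\mathcal{K})=\mathbf{I}_r$, $\mathbf{H}(:,\bar{\mathcal{K}})=\mathbf{Q}$.
   Context: $\mathbb{H}$ denotes the quaternions $\breve q=q_0+\mathtt{i}q_1+\mathtt{j}q_2+\mathtt{k}q_3$ with $q_0,\dots,q_3\in\mathbb{R}$, and $\mathcal{S}_l(\breve q)=q_l$ for $l=0,1,2,3$; $\mathcal{S}_l$ is applied entrywise to quaternion vectors and matrices and gives real vectors and matrices. $\mathbb{H}_S=\{\breve q\in\mathbb{H}: q_0\ge 0,\ q_1^2+q_2^2+q_3^2\le q_0^2\}$, and $\mathbb{H}_S^{m\times n}$ is the set of $m\times n$ matrices with entries in $\mathbb{H}_S$. $\mathbb{R}_+$ is the set of nonnegative reals. $\mathbf{A}(:,\mathcal{J})$ is the submatrix of $\mathbf{A}$ formed by the columns indexed by $\mathcal{J}$ (index sets are listed in increasing order), and $\mathbf{I}_s$ is the $s\times s$ identity matrix. A matrix $\breve{\mathbf{M}}\in\mathbb{H}_S^{m\times n}$ is separable if there exist $\breve{\mathbf{W}}\in\mathbb{H}_S^{m\times r}$ and $\mathbf{H}\in\mathbb{R}^{r\times n}_+$ with $\breve{\mathbf{M}}=\breve{\mathbf{W}}\mathbf{H}$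 and $\breve{\mathbf{W}}=\breve{\mathbf{M}}(:,\mathcal{K})$ for some index set $\mathcal{K}$ of cardinality $r$. A real matrix $\mathbf{X}$ is separable if $\mathbf{X}=\mathbf{X}(:,\mathcal{J})\mathbf{G}$ for some index set $\mathcal{J}$ and some entrywise nonnegative matrix $\mathbf{G}$. *)

theory Defs
  imports Complex_Main "Jordan_Normal_Form.DL_Submatrix"
begin

section \<open>Quaternions\<close>

datatype quat = Quat (Q0: real) (Q1: real) (Q2: real) (Q3: real)

instantiation quat :: real_algebra_1
begin

definition "0 = Quat 0 0 0 0"
definition "1 = Quat 1 0 0 0"
definition "p + q = Quat (Q0 p + Q0 q) (Q1 p + Q1 q) (Q2 p + Q2 q) (Q3 p + Q3 q)"
definition "p - q = Quat (Q0 p - Q0 q) (Q1 p - Q1 q) (Q2 p - Q2 q) (Q3 p - Q3 q)"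
definition "- q = Quat (- Q0 q) (- Q1 q) (- Q2 q) (- Q3 q)"
definition "c *\<^sub>R q = Quat (c * Q0 q) (c * Q1 q) (c * Q2 q) (c * Q3 q)"
definition "p * q = Quat
  (Q0 p * Q0 q - Q1 p * Q1 q - Q2 p * Q2 q - Q3 p * Q3 q)
  (Q0 p * Q1 q + Q1 p * Q0 q + Q2 p * Q3 q - Q3 p * Q2 q)
  (Q0 p * Q2 q - Q1 p * Q3 q + Q2 p * Q0 q + Q3 p * Q1 q)
  (Q0 p * Q3 q + Q1 p * Q2 q - Q2 p * Q1 q + Q3 p * Q0 q)"

instance
  by standard
    (simp_all add: zero_quat_def one_quat_def plus_quat_def minus_quat_def uminus_quat_def
      scaleR_quat_def times_quat_def algebra_simps)

end

definition quat_comp :: "nat \<Rightarrow> quat \<Rightarrow> real" where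
  "quat_comp l q = [Q0 q, Q1 q, Q2 q, Q3 q] ! l"

definition quat_HS :: "quat set" where
  "quat_HS = {q. Q0 q \<ge> 0 \<and> (Q1 q)\<^sup>2 + (Q2 q)\<^sup>2 + (Q3 q)\<^sup>2 \<le> (Q0 q)\<^sup>2}"


section \<open>Matrices\<close>

text \<open>Rows and columns are numbered from 0, so an index set in $\{1,\dots,n\}$ becomes a subset of
  \<^term>\<open>{0..<n}\<close>.\<close>

definition mats_over :: "'a set \<Rightarrow> nat \<Rightarrow> nat \<Rightarrow> 'a mat set" where
  "mats_over S m n = {A \<in> carrier_mat m n. elements_mat A \<subseteq> S}"

definition cols_at :: "'a mat \<Rightarrow> nat set \<Rightarrow> 'a mat" where
  "cols_at A J = submatrix A UNIV J"

definition append_cols :: "'a::zero mat \<Rightarrow> 'a mat \<Rightarrow> 'a mat" where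
  "append_cols A B = four_block_mat A B (0\<^sub>m 0 (dim_col A)) (0\<^sub>m 0 (dim_col B))"

text \<open>For two enumerations \<open>xs\<close> and \<open>ys\<close> of one index set, right multiplication by
  \<open>reorder_mat xs ys\<close> turns a matrix whose columns are listed in the order \<open>xs\<close> into the one with
  the same columns listed in the order \<open>ys\<close>.\<close>

definition reorder_mat :: "nat list \<Rightarrow> nat list \<Rightarrow> real mat" where
  "reorder_mat xs ys =
    mat (length xs) (length ys) (\<lambda>(i, j). if xs ! i = ys ! j then 1 else 0)"

definition subset_first_perm_mat :: "nat set \<Rightarrow> nat set \<Rightarrow> real mat" where
  "subset_first_perm_mat L K =
    reorder_mat (sorted_list_of_set L @ sorted_list_of_set (K - L)) (sorted_list_of_set K)"


section \<open>Separability\<close>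

definition quat_factorization :: "quat mat \<Rightarrow> nat \<Rightarrow> quat mat \<Rightarrow> real mat \<Rightarrow> bool" where
  "quat_factorization M r W H \<longleftrightarrow>
    W \<in> mats_over quat_HS (dim_row M) r \<and> H \<in> mats_over {0..} r (dim_col M) \<and>
    M = W * map_mat of_real H"

definition separable_quat_on :: "nat set \<Rightarrow> quat mat \<Rightarrow> bool" where
  "separable_quat_on K M \<longleftrightarrow> (\<exists>H. quat_factorization M (card K) (cols_at M K) H)"

definition separable_real_by :: "real mat \<Rightarrow> nat set \<Rightarrow> real mat \<Rightarrow> bool" where
  "separable_real_by X J G \<longleftrightarrow>
    J \<subseteq> {0..<dim_col X} \<and> G \<in> mats_over {0..} (card J) (dim_col X) \<and> X = cols_at X J * G"

definition compatible_components ::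
  "quat mat \<Rightarrow> nat set \<Rightarrow> (nat \<Rightarrow> nat set) \<Rightarrow> (nat \<Rightarrow> real mat) \<Rightarrow> real mat \<Rightarrow> bool" where
  "compatible_components M K Ks Hs Q \<longleftrightarrow>
    (\<forall>l\<in>{0..3}. card (Ks l) \<le> card K \<and>
       separable_real_by (map_mat (quat_comp l) M) (Ks l) (Hs l)) \<and>
    (\<exists>p\<in>{0..3}. (\<Union>l\<in>{0..3}. Ks l) = Ks p \<and> Ks p = K) \<and>
    Q \<in> mats_over {0..} (card K) (dim_col M - card K) \<and>
    (\<forall>l\<in>{0..3}. cols_at (Hs l) ({0..<dim_col M} - K) =
       append_cols (1\<^sub>m (card (Ks l))) (cols_at (Hs l) (K - Ks l))
         * subset_first_perm_mat (Ks l) K * Q)"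

end

theory Submission
  imports Defs
begin

text \<open>Right multiplication by a real matrix commutes with taking real components, so \<open>M = M(:,K) H\<close>
  holds exactly when all four components satisfy \<open>X = X(:,K) H\<close>. Hence (a) gives (b) with
  \<open>K\<^sub>l = K\<close>, \<open>H\<^sub>l = H\<close>. Conversely, with \<open>L = K\<^sub>l\<close>, \<open>G = H\<^sub>l\<close>, multiplying the
  compatibility condition from the left by \<open>X(:,L)\<close> turns \<open>[I, G(:,K - L)]\<close> into
  \<open>[X(:,L), X(:,K - L)]\<close>, which the permutation rearranges to \<open>X(:,K)\<close>; so the columns of \<open>X\<close> outside
  \<open>K\<close> are \<open>X(:,K) Q\<close>, with the same \<open>Q\<close> for every component.\<close>

section \<open>Column selection\<close>

lemma dim_cols_at [simp]:
  assumes "J \<subseteq> {0..<dim_col A}"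
  shows "dim_row (cols_at A J) = dim_row A" "dim_col (cols_at A J) = card J"
proof -
  have "{j. j < dim_col A \<and> j \<in> J} = J" using assms by auto
  then show "dim_row (cols_at A J) = dim_row A" "dim_col (cols_at A J) = card J"
    by (simp_all add: cols_at_def dim_submatrix)
qed

lemma pick_subset_less:
  assumes "J \<subseteq> {0..<n}" "j < card J"
  shows "pick J j \<in> J" "pick J j < n"
  using assms pick_in_set_le by fastforce+

lemma index_cols_at [simp]:
  assumes "J \<subseteq> {0..<dim_col A}" "i < dim_row A" "j < card J"
  shows "cols_at A J $$ (i, j) = A $$ (i, pick J j)"
proof -
  have "{j. j < dim_col A \<and> j \<in> J} = J" using assms by auto
  then show ?thesis
    using assms by (simp add: cols_at_def submatrix_index pick_UNIV)
qed

lemma cols_at_carrier: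
  assumes "A \<in> carrier_mat m n" "J \<subseteq> {0..<n}"
  shows "cols_at A J \<in> carrier_mat m (card J)"
  using assms by (auto intro: carrier_matI)

lemma cols_at_mult:
  fixes A :: "'a::semiring_0 mat"
  assumes A: "A \<in> carrier_mat m k" and B: "B \<in> carrier_mat k n" and J: "J \<subseteq> {0..<n}"
  shows "cols_at (A * B) J = A * cols_at B J"
proof (rule eq_matI)
  fix i j assume "i < dim_row (A * cols_at B J)" "j < dim_col (A * cols_at B J)"
  with A B J have ij: "i < m" "j < card J" by auto
  then show "cols_at (A * B) J $$ (i, j) = (A * cols_at B J) $$ (i, j)"
    using A B J pick_subset_less[OF J ij(2)] by (simp add: scalar_prod_def)
qed (use A B J in auto)

lemma cols_at_map_mat:
  assumes "J \<subseteq> {0..<dim_col A}"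
  shows "cols_at (map_mat f A) J = map_mat f (cols_at A J)"
  using assms pick_subset_less[OF assms] by (intro eq_matI) auto

text \<open>Serves to verify a factorization separately on the columns in \<open>K\<close>, where
  the right factor is the identity, and on the remaining ones, where it is \<open>Q\<close>.\<close>

lemma cols_at_eqI:
  assumes A: "A \<in> carrier_mat m n" and B: "B \<in> carrier_mat m n" and K: "K \<subseteq> {0..<n}"
    and eqs: "cols_at A K = cols_at B K" "cols_at A ({0..<n} - K) = cols_at B ({0..<n} - K)"
  shows "A = B"
proof (rule eq_matI)
  fix i j assume "i < dim_row B" "j < dim_col B"
  with B have ij: "i < m" "j < n" by auto
  have agree: "A $$ (i, j) = B $$ (i, j)"
    if J: "J \<subseteq> {0..<n}" and "j \<in> J" and eq: "cols_at A J = cols_at B J" for J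
  proof -
    \<comment> \<open>\<open>?k\<close> is the zero-based rank of \<open>j\<close> in
      \<open>J\<close>, so \<open>pick J ?k = j\<close>. Since \<open>j\<close> itself is not
      counted, the rank is a valid column number of \<open>cols_at A J\<close>.\<close>
    let ?k = "card {a \<in> J. a < j}"
    have "{a \<in> J. a < j} \<subset> J" using \<open>j \<in> J\<close> by auto
    moreover have "finite J" using J finite_subset by blast
    ultimately have k: "?k < card J" by (simp add: psubset_card_mono)
    have "A $$ (i, pick J ?k) = B $$ (i, pick J ?k)"
      using arg_cong[OF eq, of "\<lambda>C. C $$ (i, ?k)"] A B J ij k by simp
    then show ?thesis using pick_card_in_set[OF \<open>j \<in> J\<close>] by simp
  qed
  show "A $$ (i, j) = B $$ (i, j)"
    using agree[OF K _ eqs(1)] agree[OF _ _ eqs(2)] ij by auto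
qed (use A B in auto)

text \<open>Glues the identity on \<open>K\<close> and \<open>Q\<close> off \<open>K\<close> into
  one factor; the inclusion of entries carries nonnegativity over to it.\<close>

lemma cols_at_complementary_exists:
  assumes K: "K \<subseteq> {0..<n}" and A: "A \<in> carrier_mat r (card K)"
    and B: "B \<in> carrier_mat r (n - card K)"
  obtains H where "H \<in> carrier_mat r n" "cols_at H K = A" "cols_at H ({0..<n} - K) = B"
    "elements_mat H \<subseteq> elements_mat A \<union> elements_mat B"
proof
  let ?L = "{0..<n} - K"
  \<comment> \<open>On \<open>J\<close>, the rank \<open>pos J\<close> inverts
    \<open>pick J\<close>: it tells which column of \<open>A\<close> or \<open>B\<close> becomes
    column \<open>j\<close> of \<open>H\<close>.\<close>
  define pos where "pos J j = card {a \<in> J. a < j}" for J and j :: nat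
  define H where "H = mat r n (\<lambda>(i, j). if j \<in> K then A $$ (i, pos K j) else B $$ (i, pos ?L j))"
  have L: "card ?L = n - card K" using K by (simp add: card_Diff_subset finite_subset)
  have pos_pick: "pos J (pick J j) = j" if "j < card J" for J j
    using card_pick_le[of j J] that by (simp add: pos_def)
  have pos_less: "pos J j < card J" if "j \<in> J" "J \<subseteq> {0..<n}" for J j
    unfolding pos_def using that
    by (intro psubset_card_mono) (auto intro: finite_subset)
  show H: "H \<in> carrier_mat r n" by (simp add: H_def)
  show "cols_at H K = A"
  proof (rule eq_matI)
    fix i j assume "i < dim_row A" "j < dim_col A"
    then show "cols_at H K $$ (i, j) = A $$ (i, j)"
      using A K H pick_subset_less[OF K] by (simp add: H_def pos_pick)
  qed (use A H K in auto)
  show "cols_at H ?L = B"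
  proof (rule eq_matI)
    fix i j assume "i < dim_row B" "j < dim_col B"
    then show "cols_at H ?L $$ (i, j) = B $$ (i, j)"
      using B L H pick_subset_less[of ?L n j] by (simp add: H_def pos_pick)
  qed (use B H L in auto)
  show "elements_mat H \<subseteq> elements_mat A \<union> elements_mat B"
  proof
    fix x assume "x \<in> elements_mat H"
    then obtain i j where ij: "i < r" "j < n" "x = H $$ (i, j)"
      unfolding elements_mat_def using H by auto
    show "x \<in> elements_mat A \<union> elements_mat B"
    proof (cases "j \<in> K")
      case True
      then have "x \<in> elements_mat A"
        using ij pos_less[OF True K] by (intro elements_matI[OF A ij(1)]) (auto simp: H_def)
      then show ?thesis ..
    next
      case False
      then have "x \<in> elements_mat B"
        using ij pos_less[of j ?L] L by (intro elements_matI[OF B ij(1)]) (auto simp: H_def)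
      then show ?thesis ..
    qed
  qed
qed

section \<open>Column lists and reordering\<close>

definition cols_list :: "'a mat \<Rightarrow> nat list \<Rightarrow> 'a mat" where
  "cols_list A xs = mat (dim_row A) (length xs) (\<lambda>(i, j). A $$ (i, xs ! j))"

text \<open>A strictly increasing list is determined by its set of entries, and
  \<open>pick J\<close> enumerates \<open>J\<close> in increasing order.\<close>

lemma sorted_list_of_set_nth_pick:
  assumes "finite J" "j < card J"
  shows "sorted_list_of_set J ! j = pick J j"
proof -
  have inj: "inj_on (pick J) {0..<card J}"
    using pick_eq_iff_inf pick_mono_le by (intro inj_onI) (metis atLeastLessThan_iff linorder_neqE_nat nat_neq_iff)
  \<comment> \<open>An injective image with \<open>card J\<close> elements inside the finite set
    \<open>J\<close> exhausts \<open>J\<close>.\<close>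
  have "pick J ` {0..<card J} = J"
    using inj assms pick_in_set_le by (intro card_subset_eq) (auto simp: card_image)
  moreover have "sorted_wrt (<) (map (pick J) [0..<card J])"
    by (auto simp: sorted_wrt_iff_nth_less pick_mono_le)
  ultimately have "sorted_list_of_set J = map (pick J) [0..<card J]"
    using strict_sorted_equal strict_sorted_list_of_set
    by (metis assms(1) set_map set_sorted_list_of_set set_upt)
  with assms show ?thesis by simp
qed

text \<open>\<open>cols_at\<close> can only list columns in increasing order. Lists also express the
  order "\<open>L\<close> first, then \<open>K - L\<close>", so permutation arguments are carried
  out on them.\<close>

lemma cols_at_eq_cols_list:
  assumes "J \<subseteq> {0..<dim_col A}"
  shows "cols_at A J = cols_list A (sorted_list_of_set J)"
proof -
  have "finite J" using assms finite_subset by blast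
  then show ?thesis
    using assms by (intro eq_matI) (auto simp: cols_list_def sorted_list_of_set_nth_pick)
qed

lemma append_cols_list:
  "append_cols (cols_list A xs) (cols_list A ys) = cols_list A (xs @ ys)"
  by (rule eq_matI) (auto simp: append_cols_def cols_list_def nth_append)

text \<open>Column \<open>j\<close> of \<open>reorder_mat xs ys\<close> is the unit vector at the
  position of \<open>ys ! j\<close> in \<open>xs\<close>, so it selects a single column of the left
  factor.\<close>

lemma cols_list_mult_reorder_mat:
  assumes "distinct xs" "set ys \<subseteq> set xs"
  shows "cols_list A xs * reorder_mat xs ys = cols_list A ys"
proof (rule eq_matI)
  fix i j assume "i < dim_row (cols_list A ys)" "j < dim_col (cols_list A ys)"
  then have ij: "i < dim_row A" "j < length ys" by (auto simp: cols_list_def)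
  with assms obtain k where k: "k < length xs" "xs ! k = ys ! j"
    by (metis in_set_conv_nth nth_mem subset_iff)
  have "(cols_list A xs * reorder_mat xs ys) $$ (i, j)
      = (\<Sum>t = 0..<length xs. A $$ (i, xs ! t) * (if xs ! t = ys ! j then 1 else 0))"
    using ij by (simp add: cols_list_def reorder_mat_def scalar_prod_def)
  \<comment> \<open>As \<open>xs\<close> is distinct, its entry equals \<open>ys ! j\<close> only at
    position \<open>k\<close>, and one summand survives.\<close>
  also have "\<dots> = (\<Sum>t = 0..<length xs. if t = k then A $$ (i, xs ! t) else 0)"
    using k assms by (intro sum.cong) (auto simp: nth_eq_iff_index_eq simp flip: k(2))
  also have "\<dots> = cols_list A ys $$ (i, j)"
    using ij k by (simp add: cols_list_def)
  finally show "(cols_list A xs * reorder_mat xs ys) $$ (i, j) = cols_list A ys $$ (i, j)" .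
qed (auto simp: cols_list_def reorder_mat_def)

text \<open>\<open>L\<close> and \<open>K - L\<close> partition \<open>K\<close>, so their sorted
  lists joined together enumerate \<open>K\<close> without repetition and the reordering rule
  applies.\<close>

lemma append_cols_mult_subset_first_perm_mat:
  assumes "L \<subseteq> K" "K \<subseteq> {0..<dim_col A}"
  shows "append_cols (cols_at A L) (cols_at A (K - L)) * subset_first_perm_mat L K = cols_at A K"
proof -
  have "finite K" using assms(2) finite_subset by blast
  moreover from this have "finite L" using assms(1) finite_subset by blast
  ultimately have "distinct (sorted_list_of_set L @ sorted_list_of_set (K - L))"
    "set (sorted_list_of_set K) \<subseteq> set (sorted_list_of_set L @ sorted_list_of_set (K - L))"
    by auto
  note reorder = cols_list_mult_reorder_mat[OF this]
  have "L \<subseteq> {0..<dim_col A}" "K - L \<subseteq> {0..<dim_col A}" using assms by auto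
  then show ?thesis
    by (simp only: cols_at_eq_cols_list assms(2) append_cols_list subset_first_perm_mat_def reorder)
qed

lemma mult_append_cols:
  fixes A :: "'a::semiring_0 mat"
  assumes A: "A \<in> carrier_mat m k" and B: "B \<in> carrier_mat k p" and C: "C \<in> carrier_mat k q"
  shows "A * append_cols B C = append_cols (A * B) (A * C)"
  using assms
  by (intro eq_matI) (auto simp: append_cols_def scalar_prod_def)

lemma subset_first_perm_mat_self:
  assumes "finite K"
  shows "subset_first_perm_mat K K = 1\<^sub>m (card K)"
  using assms
  by (intro eq_matI) (auto simp: subset_first_perm_mat_def reorder_mat_def nth_eq_iff_index_eq)

lemma subset_first_perm_mat_carrier:
  assumes "L \<subseteq> K" "finite K"
  shows "subset_first_perm_mat L K \<in> carrier_mat (card K) (card K)"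
proof -
  have "card L + card (K - L) = card K"
    using assms by (metis card_Diff_subset card_mono finite_subset le_add_diff_inverse)
  then show ?thesis by (simp add: subset_first_perm_mat_def reorder_mat_def)
qed

section \<open>Quaternion components\<close>

lemma quat_comp_simps:
  assumes "l \<in> {0..3}"
  shows "quat_comp l 0 = 0" "quat_comp l (p + q) = quat_comp l p + quat_comp l q"
    "quat_comp l (p * of_real c) = quat_comp l p * c"
proof -
  have "l = 0 \<or> l = 1 \<or> l = 2 \<or> l = 3" using assms by auto
  then show "quat_comp l 0 = 0" "quat_comp l (p + q) = quat_comp l p + quat_comp l q"
    "quat_comp l (p * of_real c) = quat_comp l p * c"
    by (auto simp: quat_comp_def zero_quat_def plus_quat_def times_quat_def of_real_def
        scaleR_quat_def one_quat_def numeral_2_eq_2 numeral_3_eq_3)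
qed

lemma quat_eqI:
  assumes "\<And>l. l \<in> {0..3} \<Longrightarrow> quat_comp l p = quat_comp l q"
  shows "p = q"
  using assms[of 0] assms[of 1] assms[of 2] assms[of 3]
  by (auto intro!: quat.expand simp: quat_comp_def)

lemma quat_mat_eq_iff_components:
  fixes A B :: "quat mat"
  assumes "A \<in> carrier_mat m n" "B \<in> carrier_mat m n"
  shows "A = B \<longleftrightarrow> (\<forall>l\<in>{0..3}. map_mat (quat_comp l) A = map_mat (quat_comp l) B)"
proof
  assume eq: "\<forall>l\<in>{0..3}. map_mat (quat_comp l) A = map_mat (quat_comp l) B"
  show "A = B"
  proof (rule eq_matI)
    fix i j assume "i < dim_row B" "j < dim_col B"
    moreover have "map_mat (quat_comp l) A $$ (i, j) = map_mat (quat_comp l) B $$ (i, j)"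
      if "l \<in> {0..3}" for l using eq that by auto
    ultimately show "A $$ (i, j) = B $$ (i, j)"
      using assms by (intro quat_eqI) auto
  qed (use assms in auto)
qed simp

text \<open>A real right factor scales all four components alike, and components are additive, so
  the product does not mix them.\<close>

lemma map_mat_quat_comp_mult:
  assumes "l \<in> {0..3}" "W \<in> carrier_mat m r" "H \<in> carrier_mat r n"
  shows "map_mat (quat_comp l) (W * map_mat of_real H) = map_mat (quat_comp l) W * H"
proof -
  have "quat_comp l (sum f S) = (\<Sum>i\<in>S. quat_comp l (f i))" for f :: "nat \<Rightarrow> quat" and S
    using assms(1) by (induction S rule: infinite_finite_induct) (auto simp: quat_comp_simps)
  then show ?thesis
    using assms by (intro eq_matI) (auto simp: scalar_prod_def quat_comp_simps)
qed

lemma elements_cols_at: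
  assumes "J \<subseteq> {0..<dim_col A}"
  shows "elements_mat (cols_at A J) \<subseteq> elements_mat A"
  using assms pick_subset_less[OF assms] by (fastforce simp: elements_mat_def)

lemma cols_at_mats_over:
  assumes "A \<in> mats_over S m n" "J \<subseteq> {0..<n}"
  shows "cols_at A J \<in> mats_over S m (card J)"
  using assms elements_cols_at[of J A] by (auto simp: mats_over_def cols_at_carrier)

text \<open>The entries of \<open>cols_at M K\<close> are entries of \<open>M\<close>, hence in
  \<open>quat_HS\<close>; what remains is an equation of quaternion matrices, tested componentwise
  with the same \<open>H\<close>.\<close>

lemma quat_factorization_iff_components:
  assumes M: "M \<in> mats_over quat_HS m n" and K: "K \<subseteq> {0..<n}"
  shows "quat_factorization M (card K) (cols_at M K) H \<longleftrightarrow>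
    (\<forall>l\<in>{0..3}. separable_real_by (map_mat (quat_comp l) M) K H)"
proof (cases "H \<in> mats_over {0..} (card K) n")
  case True
  then have H: "H \<in> carrier_mat (card K) n" by (simp add: mats_over_def)
  have Mc: "M \<in> carrier_mat m n" using M by (simp add: mats_over_def)
  note WK = cols_at_carrier[OF Mc K]
  have "M = cols_at M K * map_mat of_real H \<longleftrightarrow>
      (\<forall>l\<in>{0..3}. map_mat (quat_comp l) M = cols_at (map_mat (quat_comp l) M) K * H)"
    using quat_mat_eq_iff_components[OF Mc, of "cols_at M K * map_mat of_real H"] WK H Mc K
    by (simp add: map_mat_quat_comp_mult[OF _ WK H] cols_at_map_mat mult_carrier_mat[OF WK])
  then show ?thesis
    using True Mc K cols_at_mats_over[OF M K]
    by (auto simp: quat_factorization_def separable_real_by_def)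
next
  case False
  then have "\<not> quat_factorization M (card K) (cols_at M K) H"
    using M by (auto simp: quat_factorization_def mats_over_def)
  \<comment> \<open>Failure of one component is enough to refute the right-hand side.\<close>
  moreover have "\<not> separable_real_by (map_mat (quat_comp 0) M) K H"
    using M False by (auto simp: separable_real_by_def mats_over_def)
  ultimately show ?thesis by force
qed

section \<open>Compatible components and factorizations\<close>

lemma cols_at_complement_eq_mult:
  fixes X G Q :: "real mat"
  assumes X: "X \<in> carrier_mat m n" and K: "K \<subseteq> {0..<n}" and L: "L \<subseteq> K"
    and G: "G \<in> carrier_mat (card L) n" and XG: "X = cols_at X L * G"
    and Q: "Q \<in> carrier_mat (card K) (n - card K)"
    and GQ: "cols_at G ({0..<n} - K) =
      append_cols (1\<^sub>m (card L)) (cols_at G (K - L)) * subset_first_perm_mat L K * Q"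
  shows "cols_at X ({0..<n} - K) = cols_at X K * Q"
proof -
  have fin: "finite K" using K finite_subset by blast
  have sub: "L \<subseteq> {0..<n}" "K - L \<subseteq> {0..<n}" "{0..<n} - K \<subseteq> {0..<n}" using K L by auto
  have card: "card L + card (K - L) = card K"
    using L fin by (metis card_Diff_subset card_mono finite_subset le_add_diff_inverse)
  note XL = cols_at_carrier[OF X sub(1)]
  note GK = cols_at_carrier[OF G sub(2)]
  note P = subset_first_perm_mat_carrier[OF L fin]
  have I: "append_cols (1\<^sub>m (card L)) (cols_at G (K - L)) \<in> carrier_mat (card L) (card K)"
    using GK card by (auto simp: append_cols_def)
  have "cols_at X ({0..<n} - K) = cols_at (cols_at X L * G) ({0..<n} - K)"
    using XG by simp
  also have "\<dots> = cols_at X L *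
      (append_cols (1\<^sub>m (card L)) (cols_at G (K - L)) * subset_first_perm_mat L K * Q)"
    by (simp add: cols_at_mult[OF XL G sub(3)] GQ)
  also have "\<dots> = cols_at X L * append_cols (1\<^sub>m (card L)) (cols_at G (K - L)) *
      subset_first_perm_mat L K * Q"
    using assoc_mult_mat[OF XL I P] assoc_mult_mat[OF XL mult_carrier_mat[OF I P] Q] by simp
  \<comment> \<open>Left multiplication acts blockwise, and selecting columns of \<open>G\<close>
    commutes with it. The product \<open>cols_at X L * G\<close> stays visible so that
    \<open>XG\<close> can fold it back to \<open>X\<close>.\<close>
  also have "cols_at X L * append_cols (1\<^sub>m (card L)) (cols_at G (K - L)) =
      append_cols (cols_at X L) (cols_at (cols_at X L * G) (K - L))"
    by (simp only: mult_append_cols[OF XL one_carrier_mat GK] right_mult_one_mat[OF XL]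
        cols_at_mult[OF XL G sub(2)])
  also have "\<dots> = append_cols (cols_at X L) (cols_at X (K - L))"
    using XG by simp
  also have "\<dots> * subset_first_perm_mat L K = cols_at X K"
    using L K X by (intro append_cols_mult_subset_first_perm_mat) auto
  finally show ?thesis .
qed

text \<open>For equal index sets the second block is empty and the permutation trivial, so
  compatibility only says that \<open>Q\<close> is \<open>H\<close> off \<open>K\<close>. Nothing is
  assumed about \<open>H\<close> on \<open>K\<close>; it need not be the identity.\<close>

lemma compatible_components_of_factorization:
  assumes M: "M \<in> mats_over quat_HS m n" and K: "K \<subseteq> {0..<n}"
    and fact: "quat_factorization M (card K) (cols_at M K) H"
  shows "compatible_components M K (\<lambda>_. K) (\<lambda>_. H) (cols_at H ({0..<n} - K))"
proof -
  have dim: "dim_col M = n" "dim_row M = m" using M by (auto simp: mats_over_def)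
  have fin: "finite K" using K finite_subset by blast
  have H: "H \<in> mats_over {0..} (card K) n"
    using fact dim by (simp add: quat_factorization_def)
  then have Hc: "H \<in> carrier_mat (card K) n" by (simp add: mats_over_def)
  have "card ({0..<n} - K) = n - card K" using K fin by (simp add: card_Diff_subset)
  then have Q: "cols_at H ({0..<n} - K) \<in> mats_over {0..} (card K) (n - card K)"
    using cols_at_mats_over[OF H, of "{0..<n} - K"] by auto
  have "append_cols (1\<^sub>m (card K)) (cols_at H {}) = 1\<^sub>m (card K)"
    using Hc by (intro eq_matI) (auto simp: append_cols_def)
  then show ?thesis
    using quat_factorization_iff_components[OF M K] fact Q dim fin
    by (auto simp: compatible_components_def subset_first_perm_mat_self mats_over_def)
qed

lemma factorization_of_compatible_components:
  assumes M: "M \<in> mats_over quat_HS m n" and K: "K \<subseteq> {0..<n}"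
    and comp: "compatible_components M K Ks Hs Q"
  obtains H where "H \<in> carrier_mat (card K) n" "cols_at H K = 1\<^sub>m (card K)"
    "cols_at H ({0..<n} - K) = Q" "quat_factorization M (card K) (cols_at M K) H"
proof -
  have Mc: "M \<in> carrier_mat m n" using M by (auto simp: mats_over_def)
  have Q: "Q \<in> carrier_mat (card K) (n - card K)" "elements_mat Q \<subseteq> {0..}"
    using comp Mc by (auto simp: compatible_components_def mats_over_def)
  obtain H where H: "H \<in> carrier_mat (card K) n" "cols_at H K = 1\<^sub>m (card K)"
      "cols_at H ({0..<n} - K) = Q" and el: "elements_mat H \<subseteq> elements_mat (1\<^sub>m (card K)) \<union> elements_mat Q"
    using cols_at_complementary_exists[OF K one_carrier_mat Q(1)] by blast
  have "elements_mat (1\<^sub>m (card K)) \<subseteq> {0 :: real..}"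
    by (auto simp: elements_mat_def)
  with el Q(2) H(1) have Hnn: "H \<in> mats_over {0..} (card K) n"
    by (auto simp: mats_over_def)
  have "separable_real_by (map_mat (quat_comp l) M) K H" if l: "l \<in> {0..3}" for l
  proof -
    let ?X = "map_mat (quat_comp l) M"
    have X: "?X \<in> carrier_mat m n" using Mc by simp
    \<comment> \<open>The union of all index sets is \<open>Ks p = K\<close>, which bounds each of
      them.\<close>
    have L: "Ks l \<subseteq> K"
      using comp l unfolding compatible_components_def by blast
    have G: "Hs l \<in> carrier_mat (card (Ks l)) n" "?X = cols_at ?X (Ks l) * Hs l"
      using comp l Mc by (auto simp: compatible_components_def separable_real_by_def mats_over_def)
    have "cols_at (Hs l) ({0..<n} - K) =
        append_cols (1\<^sub>m (card (Ks l))) (cols_at (Hs l) (K - Ks l)) * subset_first_perm_mat (Ks l) K * Q"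
      using comp l Mc by (auto simp: compatible_components_def)
    from cols_at_complement_eq_mult[OF X K L G Q(1) this]
    have compl: "cols_at ?X ({0..<n} - K) = cols_at ?X K * Q" .
    note XK = cols_at_carrier[OF X K]
    have "?X = cols_at ?X K * H"
    proof (rule cols_at_eqI[OF X mult_carrier_mat[OF XK H(1)] K])
      show "cols_at ?X K = cols_at (cols_at ?X K * H) K"
        using right_mult_one_mat[OF XK] by (simp add: cols_at_mult[OF XK H(1) K] H(2))
      show "cols_at ?X ({0..<n} - K) = cols_at (cols_at ?X K * H) ({0..<n} - K)"
        by (simp add: cols_at_mult[OF XK H(1)] H(3) compl)
    qed
    with Hnn K Mc show ?thesis by (simp add: separable_real_by_def)
  qed
  with quat_factorization_iff_components[OF M K] H that show thesis by blast
qed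

theorem mainTheorem1:
  fixes M :: "quat mat" and m n r :: nat and K :: "nat set"
  assumes "M \<in> mats_over quat_HS m n" and "K \<subseteq> {0..<n}" and "card K = r"
  shows "(separable_quat_on K M \<longleftrightarrow> (\<exists>Ks Hs Q. compatible_components M K Ks Hs Q)) \<and>
    (\<forall>Ks Hs Q. compatible_components M K Ks Hs Q \<longrightarrow>
      (\<exists>H \<in> carrier_mat r n. cols_at H K = 1\<^sub>m r \<and> cols_at H ({0..<n} - K) = Q \<and>
        quat_factorization M r (cols_at M K) H))"
proof -
  have "compatible_components M K (\<lambda>_. K) (\<lambda>_. H) (cols_at H ({0..<n} - K))"
    if "quat_factorization M r (cols_at M K) H" for H
    using compatible_components_of_factorization[OF assms(1,2)] that assms(3) by simp
  \<comment> \<open>This explicit factor gives both the implication from (b) to (a) and the final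
    claim.\<close>
  moreover have "\<exists>H \<in> carrier_mat r n. cols_at H K = 1\<^sub>m r \<and> cols_at H ({0..<n} - K) = Q \<and>
      quat_factorization M r (cols_at M K) H"
    if "compatible_components M K Ks Hs Q" for Ks Hs Q
    using factorization_of_compatible_components[OF assms(1,2) that] assms(3) by blast
  ultimately show ?thesis
    unfolding separable_quat_on_def assms(3) by blast
qed

end
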